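(* Let $\mathbf{A}\in\mathbb{R}^{N\times N}$, $\mathbf{B}\in\mathbb{R}^{N\times m}$, $\mathbf{C}\in\mathbb{R}^{n\times N}$. Then for every integer $i\ge 0$, $$R_i\le \operatorname{rank}(\mathbf{W})-\operatorname{rank}(\mathbf{A}\mathbf{W})\le N-\operatorname{rank}(\mathbf{A}).$$ Consequently, for any integer $0<s\le m$, if $\operatorname{rank}(\mathbf{C}\mathbf{W})=n$ and $s\ge \operatorname{rank}(\mathbf{W})-\operatorname{rank}(\mathbf{A}\mathbf{W})$, then the system is output $s$-sparse controllable.
   Context: A vector in $\mathbb{R}^m$ is $s$-sparse if at most $s$ of its entries are nonzero. The system $(\mathbf{A},\mathbf{B},\mathbf{C})$ with $\mathbf{x}_k=\mathbf{A}\mathbf{x}_{k-1}+\mathbf{B}\mathbf{u}_k$, $\mathbf{y}_k=\mathbf{C}\mathbf{x}_k$ is called output $s$-sparse controllable if there exists an integer $0<K<\infty$ such that for every initial state $\mathbf{x}_0\in\mathbb{R}^N$ and every target $\mathbf{y}_f\in\mathbb{R}^n$ there exist $s$-sparse inputs $\mathbf{u}_1,\dots,\mathbf{u}_K\in\mathbb{R}^m$ with $\mathbf{y}_K=\mathbf{C}\sum_{k=1}^K\mathbf{A}^{K-k}\mathbf{B}\mathbf{u}_k+\mathbf{C}\mathbf{A}^K\mathbf{x}_0=\mathbf{y}_f$ (the supports of the $\mathbf{u}_k$ may differ across $k$). The controllability matrix is $\mathbf{W}=[\mathbf{A}^{N-1}\mathbf{B}\ \ \mathbf{A}^{N-2}\mathbf{B}\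 \cdots\ \mathbf{B}]\in\mathbb{R}^{N\times Nm}$, and for integers $i\ge 0$, $R_i=\operatorname{rank}(\mathbf{C}\mathbf{A}^i\mathbf{W})-\operatorname{rank}(\mathbf{C}\mathbf{A}^{i+1}\mathbf{W})$. *)

theory Defs
  imports "Jordan_Normal_Form.DL_Rank"
begin

(* Rank of a real matrix with r rows (column rank = dim of the column span). *)
abbreviation rk :: "nat \<Rightarrow> real mat \<Rightarrow> nat" where
  "rk r M \<equiv> vec_space.rank r M"

(* Controllability matrix W = [A^(N-1) B  A^(N-2) B ... B], N = dim A, m = #columns of B.
   Column j belongs to block j div m (block b is A^(N-1-b) B), column j mod m inside it. *)
definition ctrb_mat :: "real mat \<Rightarrow> real mat \<Rightarrow> real mat" where
  "ctrb_mat A B = (let N = dim_row A; m = dim_col B in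
     mat N (N * m) (\<lambda>(i, j). ((A ^\<^sub>m (N - 1 - j div m)) * B) $$ (i, j mod m)))"

(* s-sparse: at most s nonzero entries *)
definition sparse_vec :: "nat \<Rightarrow> real vec \<Rightarrow> bool" where
  "sparse_vec s u \<longleftrightarrow> card {j. j < dim_vec u \<and> u $ j \<noteq> 0} \<le> s"

(* R_i = rank(C A^i W) - rank(C A^(i+1) W), as an integer *)
definition R_idx :: "real mat \<Rightarrow> real mat \<Rightarrow> real mat \<Rightarrow> nat \<Rightarrow> int" where
  "R_idx A B C i = int (rk (dim_row C) (C * (A ^\<^sub>m i) * ctrb_mat A B))
                 - int (rk (dim_row C) (C * (A ^\<^sub>m (Suc i)) * ctrb_mat A B))"

(* Output s-sparse controllability of (A,B,C), with N = dim A, m = #inputs, n = #outputs *)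
definition output_sparse_controllable :: "real mat \<Rightarrow> real mat \<Rightarrow> real mat \<Rightarrow> nat \<Rightarrow> bool" where
  "output_sparse_controllable A B C s \<longleftrightarrow>
     (let N = dim_row A; m = dim_col B; n = dim_row C in
      \<exists>K::nat. 0 < K \<and>
        (\<forall>x0 \<in> carrier_vec N. \<forall>yf \<in> carrier_vec n.
          \<exists>u :: nat \<Rightarrow> real vec.
            (\<forall>k \<in> {1..K}. u k \<in> carrier_vec m \<and> sparse_vec s (u k)) \<and>
            C *\<^sub>v (finsum_vec TYPE(real) N (\<lambda>k. (A ^\<^sub>m (K - k)) * B *\<^sub>v u k) {1..K})
              + C *\<^sub>v ((A ^\<^sub>m K) *\<^sub>v x0) = yf))"

end

(*
  Let X be the set of columns of W, i.e. the Krylov vectors A^t b with t < N and b a column of B.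
  Since span X is A-invariant, both inequalities are instances of a Frobenius-type rank inequality:
  if span Y \<subseteq> span X then rank (M X) - rank (M Y) \<le> rank X - rank Y.  Take (M, X, Y) to be
  (C A^i, X, A X) and (A, unit vectors, X).

  For controllability, extend a basis of span (A X) to one of span X by a set S of at most
  rank W - rank (A W) \<le> s columns of B.  Iterating X \<subseteq> span (B_S \<union> A X) gives
  X \<subseteq> span (krylov A B_S N \<union> A^N X).  The first part is reached during the last N steps with
  inputs supported on S.  For the second, the spans of A^p K_j (K_j the Krylov set of column j)
  stop shrinking at p = N, so A^N K_j is reached by driving column j alone for N steps; doing
  this for one column after the other reaches span X with s-sparse inputs, and C maps span X
  onto the whole output space because rank (C W) = n.
*)
theory Submission
  imports Defs
begin

section \<open>Dimension of the span of a finite set of vectors\<close>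

context vec_space
begin

definition span_dim :: "'a vec set \<Rightarrow> nat" where
  "span_dim S = vectorspace.dim class_ring (span_vs S)"

lemma rank_eq_span_dim_cols: "rank M = span_dim (set (cols M))"
  unfolding rank_def span_dim_def ..

lemma zero_in_span: "S \<subseteq> carrier_vec n \<Longrightarrow> 0\<^sub>v n \<in> span S"
  using submodule.zero_closed[OF span_is_submodule] by simp

lemma lin_indpt_empty: "lin_indpt {}"
  using fin_dim finite_basis_exists subset_li_is_li unfolding basis_def by blast

lemma maximal_lin_indpt_superset:
  assumes "finite S" "S \<subseteq> carrier_vec n" "I \<subseteq> S" "lin_indpt I"
  obtains U where "maximal U (\<lambda>T. T \<subseteq> S \<and> lin_indpt T)" "I \<subseteq> U"
  using maximal_exists_superset[of S "\<lambda>T. T \<subseteq> S \<and> lin_indpt T" I] assms by blast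

lemma maximal_lin_indpt_exists:
  assumes "finite S" "S \<subseteq> carrier_vec n"
  obtains U where "maximal U (\<lambda>T. T \<subseteq> S \<and> lin_indpt T)"
  using maximal_lin_indpt_superset[OF assms empty_subsetI lin_indpt_empty] by blast

lemma subset_span_maximal_lin_indpt:
  assumes "S \<subseteq> carrier_vec n" and U: "maximal U (\<lambda>T. T \<subseteq> S \<and> lin_indpt T)"
  shows "S \<subseteq> span U"
proof
  fix s assume s: "s \<in> S"
  have US: "U \<subseteq> S" "lin_indpt U" using U unfolding maximal_def by auto
  show "s \<in> span U"
  proof (rule ccontr)
    assume ns: "s \<notin> span U"
    then have "s \<notin> U" using span_mem US assms(1) by blast
    have "lin_indpt (U \<union> {s})"
      using lin_dep_iff_in_span[of U s] ns US assms(1) s \<open>s \<notin> U\<close> by auto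
    then have "U \<union> {s} = U" using U s US unfolding maximal_def by blast
    then show False using \<open>s \<notin> U\<close> by blast
  qed
qed

lemma span_dim_eq_card_maximal:
  assumes "finite S" "S \<subseteq> carrier_vec n" "maximal U (\<lambda>T. T \<subseteq> S \<and> lin_indpt T)"
  shows "span_dim S = card U"
  unfolding span_dim_def using dim_span[OF assms(2,1,3)] by simp

lemma card_le_span_dim_if_lin_indpt:
  assumes "finite T" "T \<subseteq> carrier_vec n" "U \<subseteq> span T" "lin_indpt U"
  shows "finite U" "card U \<le> span_dim T"
proof -
  have sub: "submodule class_ring (span T) V" using span_is_submodule assms by auto
  have vs: "vectorspace class_ring (span_vs T)"
    using assms span_is_subspace subspace_def subspace_is_vs by simp
  have li: "LinearCombinations.module.lin_indpt class_ring (span_vs T) U"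
    using span_li_not_depend(2)[OF assms(3) sub] assms(4) by simp
  have fd: "vectorspace.fin_dim class_ring (span_vs T)" using fin_dim_span[of T] assms by simp
  have "U \<subseteq> carrier (span_vs T)" using assms(3) by simp
  then show "finite U" "card U \<le> span_dim T"
    using vectorspace.li_le_dim[OF vs fd _ li] unfolding span_dim_def by auto
qed

lemma span_dim_mono:
  assumes "finite S" "S \<subseteq> carrier_vec n" "finite T" "T \<subseteq> carrier_vec n" "S \<subseteq> span T"
  shows "span_dim S \<le> span_dim T"
proof -
  obtain U where U: "maximal U (\<lambda>X. X \<subseteq> S \<and> lin_indpt X)"
    using maximal_lin_indpt_exists[OF assms(1,2)] .
  then have "U \<subseteq> S" "lin_indpt U" unfolding maximal_def by auto
  then have "card U \<le> span_dim T" using card_le_span_dim_if_lin_indpt[OF assms(3,4)] assms(5) by auto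
  then show ?thesis using span_dim_eq_card_maximal[OF assms(1,2) U] by simp
qed

lemma span_subset_if_span_dim_le:
  assumes "finite S" "S \<subseteq> carrier_vec n" "finite T" "T \<subseteq> carrier_vec n" "S \<subseteq> span T"
    and "span_dim T \<le> span_dim S"
  shows "span T \<subseteq> span S"
proof -
  obtain U where U: "maximal U (\<lambda>X. X \<subseteq> S \<and> lin_indpt X)"
    using maximal_lin_indpt_exists[OF assms(1,2)] .
  have US: "U \<subseteq> S" "lin_indpt U" using U unfolding maximal_def by auto
  have UT: "U \<subseteq> span T" using US assms(5) by auto
  have sub: "submodule class_ring (span T) V" using span_is_submodule assms by auto
  have vs: "vectorspace class_ring (span_vs T)"
    using assms span_is_subspace subspace_def subspace_is_vs by simp
  have fd: "vectorspace.fin_dim class_ring (span_vs T)" using fin_dim_span[of T] assms by simp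
  have li: "LinearCombinations.module.lin_indpt class_ring (span_vs T) U"
    using span_li_not_depend(2)[OF UT sub] US by simp
  have "vectorspace.dim class_ring (span_vs T) \<le> card U"
    using span_dim_eq_card_maximal[OF assms(1,2) U] assms(6) unfolding span_dim_def by simp
  then have "vectorspace.basis class_ring (span_vs T) U"
    using vectorspace.dim_li_is_basis[OF vs fd _ _ li] UT US assms(1) finite_subset by auto
  then have "LinearCombinations.module.span class_ring (span_vs T) U = span T"
    using vectorspace.basis_def[OF vs] by auto
  then have "span U = span T" using span_li_not_depend(1)[OF UT sub] by simp
  then show ?thesis using span_is_monotone[OF US(1)] by simp
qed

lemma span_dim_le_dim:
  assumes "finite S" "S \<subseteq> carrier_vec n"
  shows "span_dim S \<le> n"
proof -
  obtain U where U: "maximal U (\<lambda>X. X \<subseteq> S \<and> lin_indpt X)"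
    using maximal_lin_indpt_exists[OF assms] .
  then have "U \<subseteq> S" "lin_indpt U" unfolding maximal_def by auto
  then have "card U \<le> dim" using li_le_dim[OF fin_dim, of U] assms by auto
  then show ?thesis using span_dim_eq_card_maximal[OF assms U] dim_is_n by simp
qed

lemma span_dim_union_le:
  assumes "finite S" "S \<subseteq> carrier_vec n" "finite T" "T \<subseteq> carrier_vec n"
  shows "span_dim (S \<union> T) \<le> span_dim S + card T"
proof -
  have ST: "finite (S \<union> T)" "S \<union> T \<subseteq> carrier_vec n" using assms by auto
  obtain U where U: "maximal U (\<lambda>X. X \<subseteq> S \<union> T \<and> lin_indpt X)"
    using maximal_lin_indpt_exists[OF ST] .
  have US: "U \<subseteq> S \<union> T" "lin_indpt U" using U unfolding maximal_def by auto
  then have "card (U \<inter> S) \<le> span_dim S"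
    using card_le_span_dim_if_lin_indpt[OF assms(1,2), of "U \<inter> S"] in_own_span[OF assms(2)]
      subset_li_is_li by blast
  moreover have "card (U - S) \<le> card T" using US assms(3) by (intro card_mono) auto
  moreover have "card U \<le> card (U \<inter> S) + card (U - S)"
    using card_Un_le[of "U \<inter> S" "U - S"] by (metis Int_Diff_Un)
  ultimately show ?thesis using span_dim_eq_card_maximal[OF ST U] by simp
qed

lemma span_dim_strict_mono:
  assumes "finite S" "S \<subseteq> carrier_vec n" "finite T" "T \<subseteq> carrier_vec n" "S \<subseteq> span T"
    and "span S \<noteq> span T"
  shows "span_dim S < span_dim T"
proof (rule ccontr)
  assume "\<not> span_dim S < span_dim T"
  then have "span T \<subseteq> span S" using span_subset_if_span_dim_le[OF assms(1-5)] by simp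
  then show False using span_subsetI[OF assms(4,5)] assms(6) by blast
qed

lemma extend_to_spanning_subset:
  assumes "finite G" "G \<subseteq> carrier_vec n" "finite Y" "Y \<subseteq> carrier_vec n"
  obtains E where "E \<subseteq> G" "card E = span_dim (G \<union> Y) - span_dim Y" "G \<union> Y \<subseteq> span (E \<union> Y)"
proof -
  have GY: "finite (G \<union> Y)" "G \<union> Y \<subseteq> carrier_vec n" using assms by auto
  obtain J0 where J0: "maximal J0 (\<lambda>T. T \<subseteq> Y \<and> lin_indpt T)"
    using maximal_lin_indpt_exists[OF assms(3,4)] .
  have J0Y: "J0 \<subseteq> Y" "lin_indpt J0" using J0 unfolding maximal_def by auto
  obtain J where J: "maximal J (\<lambda>T. T \<subseteq> G \<union> Y \<and> lin_indpt T)" "J0 \<subseteq> J"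
    using maximal_lin_indpt_superset[OF GY, of J0] J0Y by auto
  have JGY: "J \<subseteq> G \<union> Y" "lin_indpt J" using J unfolding maximal_def by auto
  have "finite J0" using J0Y assms(3) finite_subset by blast
  have "J - J0 \<subseteq> G"
  proof
    fix e assume e: "e \<in> J - J0"
    show "e \<in> G"
    proof (rule ccontr)
      assume "e \<notin> G"
      then have "e \<in> Y" using e JGY by auto
      moreover have "lin_indpt (J0 \<union> {e})" using subset_li_is_li[OF JGY(2)] e J(2) by auto
      ultimately have "J0 \<union> {e} = J0" using J0 J0Y unfolding maximal_def by blast
      then show False using e by auto
    qed
  qed
  moreover have "card (J - J0) = span_dim (G \<union> Y) - span_dim Y"
    using card_Diff_subset[OF \<open>finite J0\<close> J(2)] span_dim_eq_card_maximal[OF GY J(1)]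
      span_dim_eq_card_maximal[OF assms(3,4) J0] by simp
  moreover have "G \<union> Y \<subseteq> span ((J - J0) \<union> Y)"
  proof -
    have "J \<subseteq> (J - J0) \<union> Y" using J0Y by auto
    then show ?thesis
      using subset_span_maximal_lin_indpt[OF GY(2) J(1)] span_is_monotone by blast
  qed
  ultimately show ?thesis using that by blast
qed

end

section \<open>Images of spans under matrices\<close>

abbreviation vspan :: "nat \<Rightarrow> 'a::field vec set \<Rightarrow> 'a vec set" where
  "vspan n \<equiv> LinearCombinations.module.span class_ring (module_vec TYPE('a) n)"

abbreviation vspan_dim :: "nat \<Rightarrow> 'a::field vec set \<Rightarrow> nat" where
  "vspan_dim n \<equiv> vec_space.span_dim n"

lemma (in vec_space) submodule_vecI:
  assumes "P \<subseteq> carrier_vec n" "0\<^sub>v n \<in> P" "\<And>v w. v \<in> P \<Longrightarrow> w \<in> P \<Longrightarrow> v + w \<in> P"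
    "\<And>c v. v \<in> P \<Longrightarrow> c \<cdot>\<^sub>v v \<in> P"
  shows "submodule class_ring P V"
  unfolding submodule_def using assms vec_module by auto

lemma mat_vec_image_span_subset:
  fixes M :: "'a::field mat"
  assumes M: "M \<in> carrier_mat r n" and S: "S \<subseteq> carrier_vec n"
  shows "(*\<^sub>v) M ` vspan n S \<subseteq> vspan r ((*\<^sub>v) M ` S)"
proof -
  interpret Vn: vec_space "TYPE('a)" n .
  interpret Vr: vec_space "TYPE('a)" r .
  have MS: "(*\<^sub>v) M ` S \<subseteq> carrier_vec r" using M S by auto
  let ?P = "{x \<in> carrier_vec n. M *\<^sub>v x \<in> vspan r ((*\<^sub>v) M ` S)}"
  have "submodule class_ring ?P Vn.V"
  proof (rule Vn.submodule_vecI)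
    have "M *\<^sub>v 0\<^sub>v n = 0\<^sub>v r" using M by auto
    then show "0\<^sub>v n \<in> ?P" using Vr.zero_in_span[OF MS] by simp
    show "v + w \<in> ?P" if "v \<in> ?P" "w \<in> ?P" for v w
    proof -
      have "M *\<^sub>v (v + w) = M *\<^sub>v v + M *\<^sub>v w"
        using that M by (simp add: mult_add_distrib_mat_vec)
      then show ?thesis using that Vr.span_add1[OF MS] by simp
    qed
    show "c \<cdot>\<^sub>v v \<in> ?P" if "v \<in> ?P" for c v
    proof -
      have "M *\<^sub>v (c \<cdot>\<^sub>v v) = c \<cdot>\<^sub>v (M *\<^sub>v v)" using that M by (simp add: mult_mat_vec)
      then show ?thesis using that Vr.smult_in_span[OF MS] by simp
    qed
  qed blast
  moreover have "S \<subseteq> ?P" using S Vr.span_mem[OF MS] by blast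
  ultimately have "vspan n S \<subseteq> ?P" using Vn.span_is_subset by blast
  then show ?thesis by blast
qed

lemma span_mat_vec_image_subset:
  fixes M :: "'a::field mat"
  assumes M: "M \<in> carrier_mat r n" and S: "S \<subseteq> carrier_vec n"
  shows "vspan r ((*\<^sub>v) M ` S) \<subseteq> (*\<^sub>v) M ` vspan n S"
proof -
  interpret Vn: vec_space "TYPE('a)" n .
  interpret Vr: vec_space "TYPE('a)" r .
  let ?I = "(*\<^sub>v) M ` vspan n S"
  have span_n: "vspan n S \<subseteq> carrier_vec n" using Vn.span_closed[OF S] by auto
  have carrier: "?I \<subseteq> carrier_vec r" using M span_n mult_mat_vec_carrier by blast
  have "0\<^sub>v n \<in> vspan n S" by (rule Vn.zero_in_span[OF S])
  then have "M *\<^sub>v 0\<^sub>v n \<in> ?I" by (rule imageI)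
  moreover have "M *\<^sub>v 0\<^sub>v n = 0\<^sub>v r" using M by auto
  ultimately have zero_mem: "0\<^sub>v r \<in> ?I" by (simp only:)
  have add: "v + w \<in> ?I" if v: "v \<in> ?I" and w: "w \<in> ?I" for v w
  proof -
    obtain a where a: "v = M *\<^sub>v a" "a \<in> vspan n S" using v by blast
    obtain b where b: "w = M *\<^sub>v b" "b \<in> vspan n S" using w by blast
    have "a + b \<in> vspan n S" using Vn.span_add1[OF S a(2) b(2)] by simp
    moreover have "v + w = M *\<^sub>v (a + b)"
      unfolding a(1) b(1)
      using mult_add_distrib_mat_vec[OF M subsetD[OF span_n a(2)] subsetD[OF span_n b(2)]] by (rule sym)
    ultimately show ?thesis by (rule rev_image_eqI)
  qed
  have smult: "c \<cdot>\<^sub>v v \<in> ?I" if v: "v \<in> ?I" for c v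
  proof -
    obtain a where a: "v = M *\<^sub>v a" "a \<in> vspan n S" using v by blast
    have "c \<cdot>\<^sub>v a \<in> vspan n S" using Vn.smult_in_span[OF S a(2)] .
    moreover have "c \<cdot>\<^sub>v v = M *\<^sub>v (c \<cdot>\<^sub>v a)"
      unfolding a(1) using mult_mat_vec[OF M subsetD[OF span_n a(2)]] by (rule sym)
    ultimately show ?thesis by (rule rev_image_eqI)
  qed
  have "submodule class_ring ?I Vr.V" using Vr.submodule_vecI[OF carrier zero_mem add smult] .
  moreover have "(*\<^sub>v) M ` S \<subseteq> ?I" using Vn.in_own_span[OF S] by blast
  ultimately show ?thesis using Vr.span_is_subset by blast
qed

lemma mat_vec_image_span:
  fixes M :: "'a::field mat"
  assumes "M \<in> carrier_mat r n" "S \<subseteq> carrier_vec n"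
  shows "(*\<^sub>v) M ` vspan n S = vspan r ((*\<^sub>v) M ` S)"
  using mat_vec_image_span_subset[OF assms] span_mat_vec_image_subset[OF assms] by (rule subset_antisym)

lemma span_dim_image_gap_le:
  fixes M :: "'a::field mat"
  assumes M: "M \<in> carrier_mat r n" and X: "finite X" "X \<subseteq> carrier_vec n"
    and Y: "finite Y" "Y \<subseteq> carrier_vec n" and YX: "Y \<subseteq> vspan n X"
  shows "vspan_dim r ((*\<^sub>v) M ` X) + vspan_dim n Y \<le> vspan_dim r ((*\<^sub>v) M ` Y) + vspan_dim n X"
proof -
  interpret Vn: vec_space "TYPE('a)" n .
  interpret Vr: vec_space "TYPE('a)" r .
  have XY: "finite (X \<union> Y)" "X \<union> Y \<subseteq> carrier_vec n" using X Y by auto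
  obtain E where E: "E \<subseteq> X" "card E = Vn.span_dim (X \<union> Y) - Vn.span_dim Y"
    "X \<union> Y \<subseteq> vspan n (E \<union> Y)"
    using Vn.extend_to_spanning_subset[OF X Y] .
  have EY: "finite (E \<union> Y)" "E \<union> Y \<subseteq> carrier_vec n" using E(1) X Y finite_subset by auto
  have "Vn.span_dim Y \<le> Vn.span_dim (X \<union> Y)"
    using Vn.span_dim_mono[OF Y XY] Vn.in_own_span[OF XY(2)] by blast
  moreover have "Vn.span_dim (X \<union> Y) \<le> Vn.span_dim X"
    using Vn.span_dim_mono[OF XY X] Vn.in_own_span[OF X(2)] YX by blast
  moreover have "Vr.span_dim ((*\<^sub>v) M ` X) \<le> Vr.span_dim ((*\<^sub>v) M ` Y) + card E"
  proof -
    have img: "\<And>Z. Z \<subseteq> carrier_vec n \<Longrightarrow> (*\<^sub>v) M ` Z \<subseteq> carrier_vec r" using M by auto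
    have "(*\<^sub>v) M ` X \<subseteq> vspan r ((*\<^sub>v) M ` (E \<union> Y))"
      using E(3) mat_vec_image_span[OF M EY(2)] by blast
    then have "Vr.span_dim ((*\<^sub>v) M ` X) \<le> Vr.span_dim ((*\<^sub>v) M ` Y \<union> (*\<^sub>v) M ` E)"
      using Vr.span_dim_mono[OF _ img[OF X(2)] _ img[OF EY(2)]] X EY by (simp add: image_Un Un_commute)
    also have "\<dots> \<le> Vr.span_dim ((*\<^sub>v) M ` Y) + card ((*\<^sub>v) M ` E)"
      using Vr.span_dim_union_le img Y EY by auto
    also have "card ((*\<^sub>v) M ` E) \<le> card E" using card_image_le EY by blast
    finally show ?thesis by simp
  qed
  ultimately show ?thesis using E(2) by linarith
qed

section \<open>Krylov sets\<close>

lemma chain_stabilizes: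
  fixes P :: "nat \<Rightarrow> 'a" and f :: "nat \<Rightarrow> nat"
  assumes propagate: "\<And>T. P T = P (Suc T) \<Longrightarrow> P (Suc T) = P (Suc (Suc T))"
    and grows: "\<And>T. P T \<noteq> P (Suc T) \<Longrightarrow> f T < f (Suc T)"
    and bounded: "\<And>T. f T \<le> N"
  shows "P (N + d) = P N"
proof -
  have stays: "P (T + d) = P T \<and> P (T + d) = P (Suc (T + d))" if "P T = P (Suc T)" for T d
  proof (induction d)
    case (Suc d)
    then show ?case using propagate[of "T + d"] by (metis add_Suc_right)
  qed (use that in simp)
  have "P N = P (Suc N)"
  proof (rule ccontr)
    assume ne: "P N \<noteq> P (Suc N)"
    have changes: "P T \<noteq> P (Suc T)" if "T \<le> N" for T
      using stays[of T "N - T"] that ne by auto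
    have "T \<le> f T" if "T \<le> Suc N" for T
      using that
    proof (induction T)
      case (Suc T)
      then show ?case using grows[OF changes, of T] by simp
    qed simp
    then have "Suc N \<le> f (Suc N)" by simp
    then show False using bounded[of "Suc N"] by simp
  qed
  then show ?thesis using stays by blast
qed

lemma pow_mat_add:
  assumes "A \<in> carrier_mat n n"
  shows "A ^\<^sub>m (p + q) = A ^\<^sub>m p * A ^\<^sub>m q"
proof (induction q)
  case (Suc q)
  have "A ^\<^sub>m (p + Suc q) = (A ^\<^sub>m p * A ^\<^sub>m q) * A" using Suc by simp
  also have "\<dots> = A ^\<^sub>m p * (A ^\<^sub>m q * A)" using assms by (intro assoc_mult_mat) auto
  finally show ?case by simp
qed (use assms in simp)

lemma pow_mat_add_mult_vec:
  assumes "A \<in> carrier_mat n n" "v \<in> carrier_vec n"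
  shows "A ^\<^sub>m (p + q) *\<^sub>v v = A ^\<^sub>m p *\<^sub>v (A ^\<^sub>m q *\<^sub>v v)"
  using pow_mat_add[OF assms(1)] assms by (simp add: assoc_mult_mat_vec[of _ n n _ n])

lemma pow_mat_Suc_mult_vec:
  assumes "A \<in> carrier_mat n n" "v \<in> carrier_vec n"
  shows "A ^\<^sub>m Suc p *\<^sub>v v = A *\<^sub>v (A ^\<^sub>m p *\<^sub>v v)"
  using pow_mat_add_mult_vec[OF assms, of 1 p] assms by simp

definition krylov :: "'a::semiring_1 mat \<Rightarrow> 'a vec set \<Rightarrow> nat \<Rightarrow> 'a vec set" where
  "krylov A G T = {A ^\<^sub>m t *\<^sub>v g | t g. t < T \<and> g \<in> G}"

lemma finite_krylov:
  assumes "finite G"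
  shows "finite (krylov A G T)"
proof -
  have "krylov A G T = (\<lambda>(t, g). A ^\<^sub>m t *\<^sub>v g) ` ({..<T} \<times> G)" unfolding krylov_def by auto
  then show ?thesis using assms by simp
qed

lemma krylov_carrier: "A \<in> carrier_mat n n \<Longrightarrow> G \<subseteq> carrier_vec n \<Longrightarrow> krylov A G T \<subseteq> carrier_vec n"
  unfolding krylov_def by (blast intro: mult_mat_vec_carrier pow_carrier_mat)

lemma krylov_mono: "T \<le> T' \<Longrightarrow> krylov A G T \<subseteq> krylov A G T'"
  unfolding krylov_def by fastforce

lemma krylov_Suc:
  assumes A: "A \<in> carrier_mat n n" and G: "G \<subseteq> carrier_vec n"
  shows "krylov A G (Suc T) = G \<union> (*\<^sub>v) A ` krylov A G T"
proof (intro equalityI subsetI)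
  fix x assume "x \<in> krylov A G (Suc T)"
  then obtain t g where tg: "t < Suc T" "g \<in> G" "x = A ^\<^sub>m t *\<^sub>v g" unfolding krylov_def by auto
  show "x \<in> G \<union> (*\<^sub>v) A ` krylov A G T"
  proof (cases t)
    case 0 then show ?thesis using tg G A by auto
  next
    case (Suc t')
    then have "x = A *\<^sub>v (A ^\<^sub>m t' *\<^sub>v g)" using tg A G pow_mat_Suc_mult_vec[OF A] by auto
    moreover have "A ^\<^sub>m t' *\<^sub>v g \<in> krylov A G T" using tg Suc unfolding krylov_def by auto
    ultimately show ?thesis by blast
  qed
next
  fix x assume "x \<in> G \<union> (*\<^sub>v) A ` krylov A G T"
  then consider "x \<in> G" | t g where "t < T" "g \<in> G" "x = A *\<^sub>v (A ^\<^sub>m t *\<^sub>v g)"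
    unfolding krylov_def by auto
  then show "x \<in> krylov A G (Suc T)"
  proof cases
    case 1
    then have "x = A ^\<^sub>m 0 *\<^sub>v x" using A G by auto
    then show ?thesis using 1 unfolding krylov_def by blast
  next
    case 2
    then have "x = A ^\<^sub>m Suc t *\<^sub>v g" using A G pow_mat_Suc_mult_vec[OF A] by auto
    then show ?thesis using 2 unfolding krylov_def by blast
  qed
qed

lemma pow_mat_Suc_image:
  assumes A: "A \<in> carrier_mat n n" and S: "S \<subseteq> carrier_vec n"
  shows "(*\<^sub>v) (A ^\<^sub>m Suc T) ` S = (*\<^sub>v) A ` (*\<^sub>v) (A ^\<^sub>m T) ` S"
    and "(*\<^sub>v) (A ^\<^sub>m Suc T) ` S = (*\<^sub>v) (A ^\<^sub>m T) ` (*\<^sub>v) A ` S"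
proof -
  have "A ^\<^sub>m Suc T *\<^sub>v v = A *\<^sub>v (A ^\<^sub>m T *\<^sub>v v)" if "v \<in> S" for v
    using pow_mat_Suc_mult_vec[OF A] that S by auto
  then show "(*\<^sub>v) (A ^\<^sub>m Suc T) ` S = (*\<^sub>v) A ` (*\<^sub>v) (A ^\<^sub>m T) ` S"
    unfolding image_image by (rule image_cong[OF refl])
  have "A ^\<^sub>m Suc T *\<^sub>v v = A ^\<^sub>m T *\<^sub>v (A *\<^sub>v v)" if "v \<in> S" for v
    using that S A assoc_mult_mat_vec[of "A ^\<^sub>m T" n n A n v] by auto
  then show "(*\<^sub>v) (A ^\<^sub>m Suc T) ` S = (*\<^sub>v) (A ^\<^sub>m T) ` (*\<^sub>v) A ` S"
    unfolding image_image by (rule image_cong[OF refl])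
qed

context vec_space
begin

lemma mult_krylov_subset_span:
  assumes A: "A \<in> carrier_mat n n" and G: "finite G" "G \<subseteq> carrier_vec n"
  shows "(*\<^sub>v) A ` krylov A G n \<subseteq> span (krylov A G n)"
proof -
  let ?K = "krylov A G"
  have K: "finite (?K T)" "?K T \<subseteq> carrier_vec n" for T
    using finite_krylov[OF G(1)] krylov_carrier[OF A G(2)] by auto
  have K_Suc: "?K (Suc T) = G \<union> (*\<^sub>v) A ` ?K T" for T using krylov_Suc[OF A G(2)] .
  have K_le_Suc: "?K T \<subseteq> span (?K (Suc T))" for T
    using subset_trans[OF krylov_mono in_own_span[OF K(2)], of T "Suc T"] by simp
  have "span (?K (n + 1)) = span (?K n)"
  proof (rule chain_stabilizes[where f = "\<lambda>T. span_dim (?K T)"])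
    fix T assume eq: "span (?K T) = span (?K (Suc T))"
    have "(*\<^sub>v) A ` ?K (Suc T) \<subseteq> (*\<^sub>v) A ` span (?K T)"
      using in_own_span[OF K(2), of "Suc T"] eq by blast
    also have "\<dots> = span ((*\<^sub>v) A ` ?K T)" by (rule mat_vec_image_span[OF A K(2)])
    also have "\<dots> \<subseteq> span (?K (Suc T))" by (rule span_is_monotone) (unfold K_Suc, blast)
    finally have "?K (Suc (Suc T)) \<subseteq> span (?K (Suc T))"
      unfolding K_Suc[of "Suc T"] using in_own_span[OF K(2), of "Suc T"] K_Suc[of T] by blast
    then show "span (?K (Suc T)) = span (?K (Suc (Suc T)))"
      using span_subsetI[OF K(2)] span_subsetI[OF K(2) K_le_Suc] by blast
  next
    fix T assume "span (?K T) \<noteq> span (?K (Suc T))"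
    then show "span_dim (?K T) < span_dim (?K (Suc T))"
      using span_dim_strict_mono[OF K K K_le_Suc] by blast
  next
    show "span_dim (?K T) \<le> n" for T using span_dim_le_dim[OF K] .
  qed
  then have "?K (Suc n) \<subseteq> span (?K n)" using in_own_span[OF K(2), of "Suc n"] by simp
  then show ?thesis using K_Suc by blast
qed

lemma pow_image_span_stable:
  assumes A: "A \<in> carrier_mat n n" and S: "finite S" "S \<subseteq> carrier_vec n"
    and invariant: "(*\<^sub>v) A ` S \<subseteq> span S"
  shows "span ((*\<^sub>v) (A ^\<^sub>m (n + p)) ` S) = span ((*\<^sub>v) (A ^\<^sub>m n) ` S)"
proof -
  let ?I = "\<lambda>T. (*\<^sub>v) (A ^\<^sub>m T) ` S"
  have I: "finite (?I T)" "?I T \<subseteq> carrier_vec n" for T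
    using A S by (auto intro!: mult_mat_vec_carrier[of _ n n])
  have Suc_le: "?I (Suc T) \<subseteq> span (?I T)" for T
  proof -
    have "?I (Suc T) \<subseteq> (*\<^sub>v) (A ^\<^sub>m T) ` span S"
      unfolding pow_mat_Suc_image(2)[OF A S(2)] by (rule image_mono[OF invariant])
    also have "\<dots> = span (?I T)" by (rule mat_vec_image_span[OF pow_carrier_mat[OF A] S(2)])
    finally show ?thesis .
  qed
  have "span (?I (n + p)) = span (?I n)"
  proof (rule chain_stabilizes[where f = "\<lambda>T. n - span_dim (?I T)"])
    fix T assume eq: "span (?I T) = span (?I (Suc T))"
    have "?I T \<subseteq> span (?I (Suc T))" using in_own_span[OF I(2), of T] unfolding eq .
    then have "(*\<^sub>v) A ` ?I T \<subseteq> (*\<^sub>v) A ` span (?I (Suc T))" by (rule image_mono)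
    then have "?I (Suc T) \<subseteq> (*\<^sub>v) A ` span (?I (Suc T))"
      by (simp only: pow_mat_Suc_image(1)[OF A S(2), of T])
    also have "\<dots> = span ((*\<^sub>v) A ` ?I (Suc T))" by (rule mat_vec_image_span[OF A I(2)])
    also have "\<dots> = span (?I (Suc (Suc T)))" by (simp only: pow_mat_Suc_image(1)[OF A S(2)])
    finally show "span (?I (Suc T)) = span (?I (Suc (Suc T)))"
      using span_subsetI[OF I(2)] span_subsetI[OF I(2) Suc_le] by blast
  next
    fix T assume "span (?I T) \<noteq> span (?I (Suc T))"
    then have "span_dim (?I (Suc T)) < span_dim (?I T)"
      using span_dim_strict_mono[OF I I Suc_le] by metis
    then show "n - span_dim (?I T) < n - span_dim (?I (Suc T))"
      using span_dim_le_dim[OF I, of T] by linarith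
  qed simp
  then show ?thesis .
qed

end

section \<open>The controllability matrix and the rank bounds\<close>

lemma set_cols_mult:
  assumes "M \<in> carrier_mat r n" "X \<in> carrier_mat n k"
  shows "set (cols (M * X)) = (*\<^sub>v) M ` set (cols X)"
  using assms by (force simp: cols_def)

lemma mult_mat_vec_zero: "M *\<^sub>v 0\<^sub>v n = (0\<^sub>v (dim_row M) :: 'a::semiring_0 vec)"
  by (intro eq_vecI) (auto simp: scalar_prod_def)

lemma mult_unit_vec_eq_col:
  fixes B :: "'a::semiring_1 mat"
  assumes "B \<in> carrier_mat n m" "j < m"
  shows "B *\<^sub>v unit_vec m j = col B j"
  using col_mult2[of B n m "1\<^sub>m m" m j] right_mult_one_mat[of B n m] assms by simp

lemma set_cols_one_mat: "set (cols (1\<^sub>m n :: 'a::zero_neq_one mat)) = set (unit_vecs n)"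
  by (force simp: cols_def unit_vecs_def)

lemma ctrb_mat_carrier: "A \<in> carrier_mat N N \<Longrightarrow> B \<in> carrier_mat N m \<Longrightarrow> ctrb_mat A B \<in> carrier_mat N (N * m)"
  unfolding ctrb_mat_def Let_def by auto

lemma col_ctrb_mat:
  assumes A: "A \<in> carrier_mat N N" and B: "B \<in> carrier_mat N m" and j: "j < N * m"
  shows "col (ctrb_mat A B) j = A ^\<^sub>m (N - 1 - j div m) *\<^sub>v col B (j mod m)"
proof -
  have "j mod m < m" using j by (cases m) auto
  then show ?thesis
    using A B j by (intro eq_vecI) (auto simp: ctrb_mat_def Let_def index_mult_mat)
qed

lemma set_cols_ctrb_mat:
  assumes A: "A \<in> carrier_mat N N" and B: "B \<in> carrier_mat N m"
  shows "set (cols (ctrb_mat A B)) = krylov A (set (cols B)) N"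
proof -
  have "set (cols (ctrb_mat A B)) = (\<lambda>j. A ^\<^sub>m (N - 1 - j div m) *\<^sub>v col B (j mod m)) ` {..<N * m}"
    using ctrb_mat_carrier[OF A B] col_ctrb_mat[OF A B] by (force simp: cols_def)
  also have "\<dots> = krylov A (set (cols B)) N"
  proof (intro equalityI subsetI)
    fix x assume "x \<in> (\<lambda>j. A ^\<^sub>m (N - 1 - j div m) *\<^sub>v col B (j mod m)) ` {..<N * m}"
    then obtain j where j: "j < N * m" "x = A ^\<^sub>m (N - 1 - j div m) *\<^sub>v col B (j mod m)" by blast
    then have "0 < m" "0 < N" by (cases m; cases N; auto)+
    then have "col B (j mod m) \<in> set (cols B)" "N - 1 - j div m < N" using B by (auto simp: cols_def)
    then show "x \<in> krylov A (set (cols B)) N" unfolding krylov_def using j by blast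
  next
    fix x assume "x \<in> krylov A (set (cols B)) N"
    then obtain t r where tr: "t < N" "r < m" "x = A ^\<^sub>m t *\<^sub>v col B r"
      using B unfolding krylov_def by (auto simp: cols_def)
    define j where "j = (N - 1 - t) * m + r"
    have "j div m = N - 1 - t" "j mod m = r" using tr unfolding j_def by auto
    moreover have "j < N * m"
    proof -
      have "j < (N - 1 - t) * m + m" using tr unfolding j_def by simp
      also have "\<dots> = (N - t) * m" using tr by (cases "N - t") auto
      also have "\<dots> \<le> N * m" by simp
      finally show ?thesis .
    qed
    ultimately show "x \<in> (\<lambda>j. A ^\<^sub>m (N - 1 - j div m) *\<^sub>v col B (j mod m)) ` {..<N * m}"
      using tr by (intro image_eqI[of _ _ j]) auto
  qed
  finally show ?thesis .
qed

lemma rank_mult_eq_span_dim_image: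
  fixes M :: "'a::field mat"
  assumes "M \<in> carrier_mat r n" "X \<in> carrier_mat n k"
  shows "vec_space.rank r (M * X) = vspan_dim r ((*\<^sub>v) M ` set (cols X))"
  unfolding vec_space.rank_eq_span_dim_cols set_cols_mult[OF assms] ..

lemma mult_cols_ctrb_mat_subset_span:
  assumes A: "A \<in> carrier_mat N N" and B: "B \<in> carrier_mat N m"
  shows "(*\<^sub>v) A ` set (cols (ctrb_mat A B)) \<subseteq> vspan N (set (cols (ctrb_mat A B)))"
proof -
  have "set (cols B) \<subseteq> carrier_vec N" using cols_dim[of B] B by simp
  then show ?thesis
    unfolding set_cols_ctrb_mat[OF A B] by (rule vec_space.mult_krylov_subset_span[OF A List.finite_set])
qed

lemma R_idx_le_ctrb_rank_drop:
  assumes A: "A \<in> carrier_mat N N" and B: "B \<in> carrier_mat N m" and C: "C \<in> carrier_mat n N"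
  shows "R_idx A B C i \<le> int (rk N (ctrb_mat A B)) - int (rk N (A * ctrb_mat A B))"
proof -
  define W where "W = ctrb_mat A B"
  define X where "X = set (cols W)"
  define M where "M = C * A ^\<^sub>m i"
  have W: "W \<in> carrier_mat N (N * m)" unfolding W_def using ctrb_mat_carrier[OF A B] .
  have M: "M \<in> carrier_mat n N" unfolding M_def using C A by auto
  have X: "finite X" "X \<subseteq> carrier_vec N" unfolding X_def using W by (auto simp: cols_def)
  have AX: "finite ((*\<^sub>v) A ` X)" "(*\<^sub>v) A ` X \<subseteq> carrier_vec N" using X A by auto
  have "C * A ^\<^sub>m Suc i = M * A" unfolding M_def using A C by (simp add: assoc_mult_mat[of C n N _ N A N])
  then have "C * A ^\<^sub>m Suc i * W = M * (A * W)" using M A W by (simp add: assoc_mult_mat[of M n N A N W])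
  then have "rk n (C * A ^\<^sub>m Suc i * W) = vspan_dim n ((*\<^sub>v) M ` (*\<^sub>v) A ` X)"
    using rank_mult_eq_span_dim_image[OF M mult_carrier_mat[OF A W]] set_cols_mult[OF A W]
    unfolding X_def by simp
  moreover have "rk n (C * A ^\<^sub>m i * W) = vspan_dim n ((*\<^sub>v) M ` X)"
    using rank_mult_eq_span_dim_image[OF M W] unfolding M_def X_def .
  moreover have "rk N W = vspan_dim N X" unfolding X_def by (rule vec_space.rank_eq_span_dim_cols)
  moreover have "rk N (A * W) = vspan_dim N ((*\<^sub>v) A ` X)"
    unfolding X_def by (rule rank_mult_eq_span_dim_image[OF A W])
  moreover have "vspan_dim n ((*\<^sub>v) M ` X) + vspan_dim N ((*\<^sub>v) A ` X)
      \<le> vspan_dim n ((*\<^sub>v) M ` (*\<^sub>v) A ` X) + vspan_dim N X"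
    using span_dim_image_gap_le[OF M X AX] mult_cols_ctrb_mat_subset_span[OF A B]
    unfolding X_def W_def by blast
  ultimately show ?thesis unfolding R_idx_def W_def using C by simp
qed

lemma ctrb_rank_drop_le_nullity:
  assumes A: "A \<in> carrier_mat N N" and B: "B \<in> carrier_mat N m"
  shows "int (rk N (ctrb_mat A B)) - int (rk N (A * ctrb_mat A B)) \<le> int N - int (rk N A)"
proof -
  interpret V: vec_space "TYPE(real)" N .
  define W where "W = ctrb_mat A B"
  define X where "X = set (cols W)"
  define U where "U = set (cols (1\<^sub>m N :: real mat))"
  have W: "W \<in> carrier_mat N (N * m)" unfolding W_def using ctrb_mat_carrier[OF A B] .
  have X: "finite X" "X \<subseteq> carrier_vec N" unfolding X_def using W by (auto simp: cols_def)
  have U: "finite U" "U \<subseteq> carrier_vec N" unfolding U_def by (auto simp: cols_def)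
  have "X \<subseteq> V.span U" unfolding U_def set_cols_one_mat V.span_unit_vecs_is_carrier by (rule X(2))
  then have "V.span_dim ((*\<^sub>v) A ` U) + V.span_dim X \<le> V.span_dim ((*\<^sub>v) A ` X) + V.span_dim U"
    using span_dim_image_gap_le[OF A U X] by blast
  moreover have "(*\<^sub>v) A ` U = set (cols A)"
    unfolding U_def using set_cols_mult[OF A one_carrier_mat] A by simp
  moreover have "V.span_dim U \<le> N" using V.span_dim_le_dim[OF U] .
  ultimately show ?thesis
    using rank_mult_eq_span_dim_image[OF A W] V.rank_eq_span_dim_cols[of W] V.rank_eq_span_dim_cols[of A]
    unfolding X_def W_def by simp
qed

section \<open>Output controllability with sparse inputs\<close>

context vec_space
begin

lemma generators_subset_span_krylov:
  assumes A: "A \<in> carrier_mat n n" and G: "G \<subseteq> carrier_vec n"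
  shows "G \<subseteq> span (krylov A G n)"
proof (rule subsetI)
  fix g assume g: "g \<in> G"
  show "g \<in> span (krylov A G n)"
  proof (cases "n = 0")
    case True
    have "dim_vec g = 0" "dim_vec (0\<^sub>v n :: 'a vec) = 0"
      using carrier_vecD[OF subsetD[OF G g]] True by (simp_all del: vec_of_dim_0)
    then have "g = 0\<^sub>v n" using vec_of_dim_0 by metis
    then show ?thesis using zero_in_span[OF krylov_carrier[OF A G]] by simp
  next
    case False
    have "g = A ^\<^sub>m 0 *\<^sub>v g" using g G A by auto
    then have "g \<in> krylov A G n" unfolding krylov_def using False g by blast
    with in_own_span[OF krylov_carrier[OF A G]] show ?thesis by (rule subsetD)
  qed
qed

lemma subset_span_krylov_pow_image:
  assumes A: "A \<in> carrier_mat n n" and G: "G \<subseteq> carrier_vec n" and X: "X \<subseteq> carrier_vec n"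
    and X_span: "X \<subseteq> span (G \<union> (*\<^sub>v) A ` X)"
  shows "X \<subseteq> span (krylov A G T \<union> (*\<^sub>v) (A ^\<^sub>m T) ` X)"
proof (induction T)
  case 0
  have "(*\<^sub>v) (A ^\<^sub>m 0) ` X = X" using X A by (force simp: image_iff)
  then show ?case using in_own_span[OF X] unfolding krylov_def by simp
next
  case (Suc T)
  let ?Z = "krylov A G (Suc T) \<union> (*\<^sub>v) (A ^\<^sub>m Suc T) ` X"
  have Z: "?Z \<subseteq> carrier_vec n"
    using krylov_carrier[OF A G] X A by (auto intro!: mult_mat_vec_carrier[of _ n n])
  have GAX: "G \<union> (*\<^sub>v) A ` X \<subseteq> carrier_vec n" using G X A by auto
  have "(*\<^sub>v) (A ^\<^sub>m T) ` X \<subseteq> (*\<^sub>v) (A ^\<^sub>m T) ` span (G \<union> (*\<^sub>v) A ` X)"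
    using X_span by (rule image_mono)
  also have "\<dots> = span ((*\<^sub>v) (A ^\<^sub>m T) ` (G \<union> (*\<^sub>v) A ` X))"
    by (rule mat_vec_image_span[OF pow_carrier_mat[OF A] GAX])
  also have "\<dots> = span ((*\<^sub>v) (A ^\<^sub>m T) ` G \<union> (*\<^sub>v) (A ^\<^sub>m Suc T) ` X)"
    by (simp only: image_Un pow_mat_Suc_image(2)[OF A X])
  also have "\<dots> \<subseteq> span ?Z"
  proof (rule span_is_monotone)
    have "(*\<^sub>v) (A ^\<^sub>m T) ` G \<subseteq> krylov A G (Suc T)" unfolding krylov_def using lessI by blast
    then show "(*\<^sub>v) (A ^\<^sub>m T) ` G \<union> (*\<^sub>v) (A ^\<^sub>m Suc T) ` X \<subseteq> ?Z"
      by (rule Un_mono[OF _ subset_refl])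
  qed
  finally have "(*\<^sub>v) (A ^\<^sub>m T) ` X \<subseteq> span ?Z" .
  moreover have "krylov A G T \<subseteq> span ?Z"
  proof -
    have "krylov A G T \<subseteq> ?Z" by (rule subset_trans[OF krylov_mono Un_upper1]) simp
    then show ?thesis using in_own_span[OF Z] by (rule subset_trans)
  qed
  ultimately have "krylov A G T \<union> (*\<^sub>v) (A ^\<^sub>m T) ` X \<subseteq> span ?Z" by (intro Un_least)
  then have "span (krylov A G T \<union> (*\<^sub>v) (A ^\<^sub>m T) ` X) \<subseteq> span ?Z" by (rule span_subsetI[OF Z])
  with Suc.IH show ?case by (rule subset_trans)
qed

lemma exists_few_columns_spanning_krylov:
  assumes A: "A \<in> carrier_mat n n" and B: "B \<in> carrier_mat n m"
  defines "X \<equiv> krylov A (set (cols B)) n"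
  obtains S where "S \<subseteq> {..<m}" "card S \<le> span_dim X - span_dim ((*\<^sub>v) A ` X)"
    "X \<subseteq> span (col B ` S \<union> (*\<^sub>v) A ` X)"
proof -
  let ?G = "set (cols B)" and ?Y = "(*\<^sub>v) A ` X"
  have G: "finite ?G" "?G \<subseteq> carrier_vec n" "?G = col B ` {..<m}"
    using cols_dim[of B] B by (auto simp: cols_def)
  have X: "finite X" "X \<subseteq> carrier_vec n"
    unfolding X_def using finite_krylov[OF G(1)] krylov_carrier[OF A G(2)] by auto
  have Y: "finite ?Y" "?Y \<subseteq> carrier_vec n" using X A by auto
  obtain E where E: "E \<subseteq> ?G" "card E = span_dim (?G \<union> ?Y) - span_dim ?Y" "?G \<union> ?Y \<subseteq> span (E \<union> ?Y)"
    using extend_to_spanning_subset[OF G(1,2) Y] .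
  have "?G \<union> ?Y \<subseteq> span X"
    using generators_subset_span_krylov[OF A G(2)] mult_krylov_subset_span[OF A G(1,2)]
    unfolding X_def by (rule Un_least)
  then have dim_le: "span_dim (?G \<union> ?Y) \<le> span_dim X"
    using span_dim_mono[of "?G \<union> ?Y" X] G Y X by simp
  obtain S where S: "S \<subseteq> {..<m}" "inj_on (col B) S" "E = col B ` S"
    using E(1) unfolding G(3) subset_image_inj by blast
  show ?thesis
  proof (rule that[OF S(1)])
    show "card S \<le> span_dim X - span_dim ?Y"
      using card_image[OF S(2)] S(3) E(2) dim_le by simp
    have "X \<subseteq> krylov A ?G (Suc n)" unfolding X_def by (rule krylov_mono) simp
    also have "\<dots> = ?G \<union> ?Y" unfolding X_def by (rule krylov_Suc[OF A G(2)])
    also have "\<dots> \<subseteq> span (col B ` S \<union> ?Y)" using E(3) unfolding S(3) .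
    finally show "X \<subseteq> span (col B ` S \<union> ?Y)" .
  qed
qed

end

definition reach :: "'a::field mat \<Rightarrow> 'a mat \<Rightarrow> nat \<Rightarrow> (nat \<Rightarrow> 'a vec) \<Rightarrow> 'a vec" where
  "reach A B K u = finsum_vec TYPE('a) (dim_row A) (\<lambda>k. A ^\<^sub>m (K - k) * B *\<^sub>v u k) {1..K}"

text \<open>Supports are indexed by the exponent \<open>K - k\<close> of \<open>A\<close> with which the input \<open>u k\<close> enters
  \<open>reach A B K u\<close>, i.e. by the number of steps remaining after time \<open>k\<close>.\<close>

definition inputs_supported_on :: "nat \<Rightarrow> (nat \<Rightarrow> nat set) \<Rightarrow> nat \<Rightarrow> (nat \<Rightarrow> 'a::zero vec) \<Rightarrow> bool" where
  "inputs_supported_on m supp K u \<longleftrightarrow>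
     (\<forall>k\<in>{1..K}. u k \<in> carrier_vec m \<and> (\<forall>j<m. j \<notin> supp (K - k) \<longrightarrow> u k $ j = 0))"

lemma (in vec_space) reach_eq_finsum:
  "A \<in> carrier_mat n n \<Longrightarrow> reach A B K u = finsum V (\<lambda>k. A ^\<^sub>m (K - k) * B *\<^sub>v u k) {1..K}"
  unfolding reach_def by simp

definition reachable_set :: "'a::field mat \<Rightarrow> 'a mat \<Rightarrow> (nat \<Rightarrow> nat set) \<Rightarrow> nat \<Rightarrow> 'a vec set" where
  "reachable_set A B supp K = {reach A B K u | u. inputs_supported_on (dim_col B) supp K u}"

lemma reach_carrier:
  fixes A B :: "'a::field mat"
  assumes A: "A \<in> carrier_mat N N" and B: "B \<in> carrier_mat N m"
    and u: "\<And>k. k \<in> {1..K} \<Longrightarrow> u k \<in> carrier_vec m"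
  shows "reach A B K u \<in> carrier_vec N"
proof -
  interpret V: vec_space "TYPE('a)" N .
  have "(\<lambda>k. A ^\<^sub>m (K - k) * B *\<^sub>v u k) \<in> {1..K} \<rightarrow> carrier_vec N"
    using A B u by (auto intro!: mult_mat_vec_carrier[of _ N m])
  then show ?thesis unfolding reach_def using A V.finsum_closed by auto
qed

lemma reach_add:
  fixes A B :: "'a::field mat"
  assumes A: "A \<in> carrier_mat N N" and B: "B \<in> carrier_mat N m"
    and u: "\<And>k. k \<in> {1..K} \<Longrightarrow> u k \<in> carrier_vec m"
    and v: "\<And>k. k \<in> {1..K} \<Longrightarrow> v k \<in> carrier_vec m"
  shows "reach A B K (\<lambda>k. u k + v k) = reach A B K u + reach A B K v"
proof -
  interpret V: vec_space "TYPE('a)" N .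
  let ?M = "\<lambda>k. A ^\<^sub>m (K - k) * B"
  have M: "?M k \<in> carrier_mat N m" for k using A B by auto
  have Mu: "(\<lambda>k. ?M k *\<^sub>v u k) \<in> {1..K} \<rightarrow> carrier_vec N"
    by (rule Pi_I) (rule mult_mat_vec_carrier[OF M u])
  have Mv: "(\<lambda>k. ?M k *\<^sub>v v k) \<in> {1..K} \<rightarrow> carrier_vec N"
    by (rule Pi_I) (rule mult_mat_vec_carrier[OF M v])
  have "reach A B K (\<lambda>k. u k + v k) = finsum V.V (\<lambda>k. ?M k *\<^sub>v u k + ?M k *\<^sub>v v k) {1..K}"
    unfolding V.reach_eq_finsum[OF A] using Mu Mv u v
    by (intro V.finsum_cong') (auto simp: mult_add_distrib_mat_vec[OF M])
  also have "\<dots> = reach A B K u + reach A B K v"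
    unfolding V.reach_eq_finsum[OF A] using V.finsum_addf[OF Mu Mv] by simp
  finally show ?thesis .
qed

lemma reach_smult:
  fixes A B :: "'a::field mat"
  assumes A: "A \<in> carrier_mat N N" and B: "B \<in> carrier_mat N m"
    and u: "\<And>k. k \<in> {1..K} \<Longrightarrow> u k \<in> carrier_vec m"
  shows "reach A B K (\<lambda>k. c \<cdot>\<^sub>v u k) = c \<cdot>\<^sub>v reach A B K u"
proof -
  interpret V: vec_space "TYPE('a)" N .
  let ?M = "\<lambda>k. A ^\<^sub>m (K - k) * B"
  have M: "?M k \<in> carrier_mat N m" for k using A B by auto
  have Mu: "(\<lambda>k. ?M k *\<^sub>v u k) \<in> {1..K} \<rightarrow> carrier_vec N"
    by (rule Pi_I) (rule mult_mat_vec_carrier[OF M u])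
  have "reach A B K (\<lambda>k. c \<cdot>\<^sub>v u k) = finsum V.V (\<lambda>k. c \<cdot>\<^sub>v (?M k *\<^sub>v u k)) {1..K}"
    unfolding V.reach_eq_finsum[OF A] using Mu u by (intro V.finsum_cong') (auto simp: mult_mat_vec[OF M])
  also have "\<dots> = c \<cdot>\<^sub>v reach A B K u"
    unfolding V.reach_eq_finsum[OF A] using V.finsum_smult[OF _ Mu, of c] by simp
  finally show ?thesis .
qed

lemma reach_zero:
  fixes A B :: "'a::field mat"
  assumes A: "A \<in> carrier_mat N N" and B: "B \<in> carrier_mat N m"
  shows "reach A B K (\<lambda>k. 0\<^sub>v m) = 0\<^sub>v N"
proof -
  interpret V: vec_space "TYPE('a)" N .
  have "reach A B K (\<lambda>k. 0\<^sub>v m) = finsum V.V (\<lambda>k. \<zero>\<^bsub>V.V\<^esub>) {1..K}"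
    unfolding V.reach_eq_finsum[OF A] using A B by (intro V.finsum_cong') (auto simp: mult_mat_vec_zero)
  then show ?thesis by simp
qed

lemma reachable_set_submodule:
  fixes A B :: "'a::field mat"
  assumes A: "A \<in> carrier_mat N N" and B: "B \<in> carrier_mat N m"
  shows "submodule class_ring (reachable_set A B supp K) (module_vec TYPE('a) N)"
proof -
  interpret V: vec_space "TYPE('a)" N .
  have inputs: "u k \<in> carrier_vec m" if "inputs_supported_on m supp K u" "k \<in> {1..K}" for u k
    using that unfolding inputs_supported_on_def by blast
  have m: "dim_col B = m" using B by simp
  show ?thesis
  proof (rule V.submodule_vecI)
    show "reachable_set A B supp K \<subseteq> carrier_vec N"
      unfolding reachable_set_def m using reach_carrier[OF A B] inputs by blast
    have "inputs_supported_on m supp K (\<lambda>k. 0\<^sub>v m)" unfolding inputs_supported_on_def by simp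
    moreover note reach_zero[OF A B, symmetric]
    ultimately show "0\<^sub>v N \<in> reachable_set A B supp K" unfolding reachable_set_def m by blast
  next
    fix x y assume "x \<in> reachable_set A B supp K" "y \<in> reachable_set A B supp K"
    then obtain u v where u: "inputs_supported_on m supp K u" "x = reach A B K u"
      and v: "inputs_supported_on m supp K v" "y = reach A B K v"
      unfolding reachable_set_def m by blast
    have "inputs_supported_on m supp K (\<lambda>k. u k + v k)"
      using u(1) v(1) unfolding inputs_supported_on_def by auto
    moreover have "x + y = reach A B K (\<lambda>k. u k + v k)"
      unfolding u(2) v(2) by (rule reach_add[OF A B inputs[OF u(1)] inputs[OF v(1)], symmetric])
    ultimately show "x + y \<in> reachable_set A B supp K" unfolding reachable_set_def m by blast
  next
    fix c x assume "x \<in> reachable_set A B supp K"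
    then obtain u where u: "inputs_supported_on m supp K u" "x = reach A B K u"
      unfolding reachable_set_def m by blast
    have "inputs_supported_on m supp K (\<lambda>k. c \<cdot>\<^sub>v u k)"
      using u(1) unfolding inputs_supported_on_def by auto
    moreover have "c \<cdot>\<^sub>v x = reach A B K (\<lambda>k. c \<cdot>\<^sub>v u k)"
      unfolding u(2) by (rule reach_smult[OF A B inputs[OF u(1)], symmetric])
    ultimately show "c \<cdot>\<^sub>v x \<in> reachable_set A B supp K" unfolding reachable_set_def m by blast
  qed
qed

lemma pow_mat_col_in_reachable_set:
  fixes A B :: "'a::field mat"
  assumes A: "A \<in> carrier_mat N N" and B: "B \<in> carrier_mat N m"
    and e: "e < K" and j: "j < m" "j \<in> supp e"
  shows "A ^\<^sub>m e *\<^sub>v col B j \<in> reachable_set A B supp K"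
proof -
  interpret V: vec_space "TYPE('a)" N .
  define u :: "nat \<Rightarrow> 'a vec" where "u k = (if K - e = k then unit_vec m j else 0\<^sub>v m)" for k
  have "inputs_supported_on m supp K u"
    unfolding inputs_supported_on_def u_def using j by auto
  moreover have "reach A B K u = A ^\<^sub>m e *\<^sub>v col B j"
  proof -
    let ?f = "\<lambda>k. A ^\<^sub>m (K - k) * B *\<^sub>v unit_vec m j"
    have f: "?f \<in> {1..K} \<rightarrow> carrier_vec N" using A B by (auto intro!: mult_mat_vec_carrier[of _ N m])
    have "reach A B K u = finsum V.V (\<lambda>k. if K - e = k then ?f k else 0\<^sub>v N) {1..K}"
      unfolding V.reach_eq_finsum[OF A] u_def using f A by (intro V.finsum_cong') (auto simp: mult_mat_vec_zero)
    also have "\<dots> = ?f (K - e)" using V.finsum_singleton[OF _ _ f, of "K - e"] e by simp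
    also have "\<dots> = A ^\<^sub>m e *\<^sub>v (B *\<^sub>v unit_vec m j)"
      using e A B by (simp add: assoc_mult_mat_vec[of _ N N B m])
    finally show ?thesis using mult_unit_vec_eq_col[OF B j(1)] by simp
  qed
  ultimately show ?thesis unfolding reachable_set_def using B by force
qed

lemma sparse_vec_if_inputs_supported_on:
  assumes "inputs_supported_on m supp K u" "k \<in> {1..K}" "finite (supp (K - k))" "card (supp (K - k)) \<le> s"
  shows "sparse_vec s (u k)"
proof -
  have "u k \<in> carrier_vec m" "\<forall>j<m. j \<notin> supp (K - k) \<longrightarrow> u k $ j = 0"
    using assms(1,2) unfolding inputs_supported_on_def by blast+
  then have "{j. j < dim_vec (u k) \<and> u k $ j \<noteq> 0} \<subseteq> supp (K - k)" by auto
  then show ?thesis unfolding sparse_vec_def using card_mono assms(3,4) le_trans by blast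
qed

text \<open>During the last \<open>N\<close> steps the inputs use the columns in \<open>S\<close>; before that, column \<open>j\<close>
  is used alone during the \<open>N\<close> steps with exponents \<open>N + j N \<le> e < N + (j + 1) N\<close>.\<close>

definition sparse_schedule :: "nat \<Rightarrow> nat set \<Rightarrow> nat \<Rightarrow> nat set" where
  "sparse_schedule N S e = (if e < N then S else {(e - N) div N})"

lemma pow_image_column_krylov_subset_reachable_set:
  fixes A B :: "'a::field mat"
  assumes A: "A \<in> carrier_mat N N" and B: "B \<in> carrier_mat N m" and j: "j < m"
    and K: "N * Suc m \<le> K"
  shows "(*\<^sub>v) (A ^\<^sub>m (N + j * N)) ` krylov A {col B j} N \<subseteq> reachable_set A B (sparse_schedule N S) K"
proof (rule subsetI)
  fix z assume "z \<in> (*\<^sub>v) (A ^\<^sub>m (N + j * N)) ` krylov A {col B j} N"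
  then obtain t where t: "t < N" "z = A ^\<^sub>m (N + j * N) *\<^sub>v (A ^\<^sub>m t *\<^sub>v col B j)"
    unfolding krylov_def by blast
  then have "z = A ^\<^sub>m (N + j * N + t) *\<^sub>v col B j"
    using pow_mat_add_mult_vec[OF A] B j by simp
  moreover have "N + j * N + t < K"
  proof -
    have "j * N + t < Suc j * N" using t(1) by simp
    also have "\<dots> \<le> m * N" using j by (intro mult_le_mono1) simp
    finally show ?thesis using K by (simp add: mult.commute)
  qed
  moreover have "sparse_schedule N S (N + j * N + t) = {j}"
    unfolding sparse_schedule_def using t(1) by simp
  ultimately show "z \<in> reachable_set A B (sparse_schedule N S) K"
    using pow_mat_col_in_reachable_set[OF A B _ j] by simp
qed

lemma pow_image_krylov_subset_reachable_set:
  fixes A B :: "'a::field mat"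
  assumes A: "A \<in> carrier_mat N N" and B: "B \<in> carrier_mat N m" and K: "N * Suc m \<le> K"
  shows "(*\<^sub>v) (A ^\<^sub>m N) ` krylov A (set (cols B)) N \<subseteq> reachable_set A B (sparse_schedule N S) K"
proof (rule subsetI)
  interpret V: vec_space "TYPE('a)" N .
  let ?R = "reachable_set A B (sparse_schedule N S) K"
  fix y assume "y \<in> (*\<^sub>v) (A ^\<^sub>m N) ` krylov A (set (cols B)) N"
  then obtain t j where tj: "t < N" "j < m" "y = A ^\<^sub>m N *\<^sub>v (A ^\<^sub>m t *\<^sub>v col B j)"
    unfolding krylov_def using B by (auto simp: cols_def)
  let ?Kj = "krylov A {col B j} N"
  have col: "{col B j} \<subseteq> carrier_vec N" using B tj(2) by auto
  have Kj: "finite ?Kj" "?Kj \<subseteq> carrier_vec N"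
    using finite_krylov[of "{col B j}"] krylov_carrier[OF A col] by auto
  have "V.span ((*\<^sub>v) (A ^\<^sub>m (N + j * N)) ` ?Kj) \<subseteq> ?R"
    using V.span_is_subset[OF pow_image_column_krylov_subset_reachable_set[OF A B tj(2) K]
      reachable_set_submodule[OF A B]] .
  moreover have "V.span ((*\<^sub>v) (A ^\<^sub>m (N + j * N)) ` ?Kj) = V.span ((*\<^sub>v) (A ^\<^sub>m N) ` ?Kj)"
    by (rule V.pow_image_span_stable[OF A Kj V.mult_krylov_subset_span[OF A _ col]]) simp
  ultimately have span_R: "V.span ((*\<^sub>v) (A ^\<^sub>m N) ` ?Kj) \<subseteq> ?R" by simp
  have "A ^\<^sub>m t *\<^sub>v col B j \<in> ?Kj" unfolding krylov_def using tj(1) by blast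
  then have y: "y \<in> (*\<^sub>v) (A ^\<^sub>m N) ` ?Kj" using tj(3) by (rule rev_image_eqI)
  have "(*\<^sub>v) (A ^\<^sub>m N) ` ?Kj \<subseteq> carrier_vec N"
    using Kj(2) A by (auto intro!: mult_mat_vec_carrier[of _ N N])
  from V.in_own_span[OF this] y have "y \<in> V.span ((*\<^sub>v) (A ^\<^sub>m N) ` ?Kj)" by (rule subsetD)
  with span_R show "y \<in> ?R" by (rule subsetD)
qed

lemma span_krylov_subset_reachable_set:
  fixes A B :: "'a::field mat"
  assumes A: "A \<in> carrier_mat N N" and B: "B \<in> carrier_mat N m"
    and S: "S \<subseteq> {..<m}" and K: "N * Suc m \<le> K"
    and X_span: "krylov A (set (cols B)) N
      \<subseteq> vspan N (col B ` S \<union> (*\<^sub>v) A ` krylov A (set (cols B)) N)"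
  shows "vspan N (krylov A (set (cols B)) N) \<subseteq> reachable_set A B (sparse_schedule N S) K"
proof -
  interpret V: vec_space "TYPE('a)" N .
  let ?X = "krylov A (set (cols B)) N" and ?R = "reachable_set A B (sparse_schedule N S) K"
  have R: "submodule class_ring ?R V.V" by (rule reachable_set_submodule[OF A B])
  have BS: "col B ` S \<subseteq> carrier_vec N" using S B by auto
  have X: "?X \<subseteq> carrier_vec N" using krylov_carrier[OF A] B by (simp add: cols_def image_subset_iff)
  have "krylov A (col B ` S) N \<subseteq> ?R"
  proof (rule subsetI)
    fix x assume "x \<in> krylov A (col B ` S) N"
    then obtain t i where "t < N" "i \<in> S" "x = A ^\<^sub>m t *\<^sub>v col B i" unfolding krylov_def by blast
    moreover from this have "t < K" using K by simp
    ultimately show "x \<in> ?R"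
      using pow_mat_col_in_reachable_set[OF A B] S unfolding sparse_schedule_def by auto
  qed
  moreover have "(*\<^sub>v) (A ^\<^sub>m N) ` ?X \<subseteq> ?R" by (rule pow_image_krylov_subset_reachable_set[OF A B K])
  ultimately have "krylov A (col B ` S) N \<union> (*\<^sub>v) (A ^\<^sub>m N) ` ?X \<subseteq> ?R" by (rule Un_least)
  then have "V.span (krylov A (col B ` S) N \<union> (*\<^sub>v) (A ^\<^sub>m N) ` ?X) \<subseteq> ?R"
    by (rule V.span_is_subset[OF _ R])
  with V.subset_span_krylov_pow_image[OF A BS X X_span] have "?X \<subseteq> ?R" by (rule subset_trans)
  then show ?thesis by (rule V.span_is_subset[OF _ R])
qed

lemma mat_vec_image_span_eq_carrier:
  fixes M :: "'a::field mat"
  assumes M: "M \<in> carrier_mat r n" and X: "finite X" "X \<subseteq> carrier_vec n"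
    and full: "vspan_dim r ((*\<^sub>v) M ` X) = r"
  shows "(*\<^sub>v) M ` vspan n X = carrier_vec r"
proof -
  interpret Vn: vec_space "TYPE('a)" n .
  interpret Vr: vec_space "TYPE('a)" r .
  let ?U = "set (unit_vecs r) :: 'a vec set"
  have U: "finite ?U" "?U \<subseteq> carrier_vec r" using unit_vecs_carrier by auto
  have MX: "finite ((*\<^sub>v) M ` X)" "(*\<^sub>v) M ` X \<subseteq> carrier_vec r" using X M by auto
  have "carrier_vec r \<subseteq> Vr.span ((*\<^sub>v) M ` X)"
    using Vr.span_subset_if_span_dim_le[OF MX U] Vr.span_dim_le_dim[OF U] MX(2) full
    unfolding Vr.span_unit_vecs_is_carrier by simp
  also have "\<dots> = (*\<^sub>v) M ` vspan n X" by (rule mat_vec_image_span[OF M X(2), symmetric])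
  finally show ?thesis using mult_mat_vec_carrier[OF M] Vn.span_closed[OF X(2)] by blast
qed

lemma output_sparse_controllable_if_reachable:
  fixes A B C :: "real mat"
  assumes A: "A \<in> carrier_mat N N" and B: "B \<in> carrier_mat N m" and C: "C \<in> carrier_mat n N"
    and K: "0 < K" and supp: "\<And>e. finite (supp e) \<and> card (supp e) \<le> s"
    and onto: "carrier_vec n \<subseteq> (*\<^sub>v) C ` reachable_set A B supp K"
  shows "output_sparse_controllable A B C s"
proof -
  have dims: "dim_row A = N" "dim_col B = m" "dim_row C = n" using A B C by auto
  show ?thesis unfolding output_sparse_controllable_def Let_def dims
  proof (intro exI[of _ K] conjI ballI K)
    fix x0 yf :: "real vec" assume x0: "x0 \<in> carrier_vec N" and yf: "yf \<in> carrier_vec n"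
    define z where "z = C *\<^sub>v (A ^\<^sub>m K *\<^sub>v x0)"
    have z: "z \<in> carrier_vec n" unfolding z_def using C A x0 by (metis mult_mat_vec_carrier pow_carrier_mat)
    then have "yf - z \<in> (*\<^sub>v) C ` reachable_set A B supp K" using onto yf by auto
    then obtain u where u: "inputs_supported_on m supp K u" "yf - z = C *\<^sub>v reach A B K u"
      unfolding reachable_set_def dims by blast
    show "\<exists>u. (\<forall>k\<in>{1..K}. u k \<in> carrier_vec m \<and> sparse_vec s (u k)) \<and>
        C *\<^sub>v finsum_vec TYPE(real) N (\<lambda>k. A ^\<^sub>m (K - k) * B *\<^sub>v u k) {1..K} + C *\<^sub>v (A ^\<^sub>m K *\<^sub>v x0) = yf"
    proof (intro exI[of _ u] conjI ballI)
      fix k assume "k \<in> {1..K}"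
      then show "u k \<in> carrier_vec m" "sparse_vec s (u k)"
        using u(1) sparse_vec_if_inputs_supported_on supp unfolding inputs_supported_on_def by auto
    next
      have "C *\<^sub>v finsum_vec TYPE(real) N (\<lambda>k. A ^\<^sub>m (K - k) * B *\<^sub>v u k) {1..K} = yf - z"
        using u(2) unfolding reach_def dims by simp
      then show "C *\<^sub>v finsum_vec TYPE(real) N (\<lambda>k. A ^\<^sub>m (K - k) * B *\<^sub>v u k) {1..K}
          + C *\<^sub>v (A ^\<^sub>m K *\<^sub>v x0) = yf"
        using yf z unfolding z_def[symmetric] by auto
    qed
  qed
qed

lemma ctrb_output_sparse_controllable:
  assumes A: "A \<in> carrier_mat N N" and B: "B \<in> carrier_mat N m" and C: "C \<in> carrier_mat n N"
    and s: "0 < s" and full: "rk n (C * ctrb_mat A B) = n"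
    and drop: "int (rk N (ctrb_mat A B)) - int (rk N (A * ctrb_mat A B)) \<le> int s"
  shows "output_sparse_controllable A B C s"
proof -
  interpret V: vec_space "TYPE(real)" N .
  let ?X = "krylov A (set (cols B)) N" and ?K = "Suc (N * Suc m)"
  have W: "ctrb_mat A B \<in> carrier_mat N (N * m)" by (rule ctrb_mat_carrier[OF A B])
  have X: "finite ?X" "?X \<subseteq> carrier_vec N"
    using cols_dim[of "ctrb_mat A B"] W unfolding set_cols_ctrb_mat[OF A B, symmetric] by auto
  obtain S where S: "S \<subseteq> {..<m}" "card S \<le> V.span_dim ?X - V.span_dim ((*\<^sub>v) A ` ?X)"
    "?X \<subseteq> V.span (col B ` S \<union> (*\<^sub>v) A ` ?X)"
    using V.exists_few_columns_spanning_krylov[OF A B] .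
  have "rk N (ctrb_mat A B) = V.span_dim ?X"
    using V.rank_eq_span_dim_cols set_cols_ctrb_mat[OF A B] by simp
  moreover have "rk N (A * ctrb_mat A B) = V.span_dim ((*\<^sub>v) A ` ?X)"
    using rank_mult_eq_span_dim_image[OF A W] set_cols_ctrb_mat[OF A B] by simp
  ultimately have "card S \<le> s" using S(2) drop by linarith
  then have supp: "finite (sparse_schedule N S e) \<and> card (sparse_schedule N S e) \<le> s" for e
    using S(1) s finite_subset unfolding sparse_schedule_def by auto
  have "carrier_vec n = (*\<^sub>v) C ` V.span ?X"
    using mat_vec_image_span_eq_carrier[OF C X] full rank_mult_eq_span_dim_image[OF C W]
      set_cols_ctrb_mat[OF A B] by simp
  also have "\<dots> \<subseteq> (*\<^sub>v) C ` reachable_set A B (sparse_schedule N S) ?K"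
    using span_krylov_subset_reachable_set[OF A B S(1) _ S(3)] by (intro image_mono) simp
  finally show ?thesis by (rule output_sparse_controllable_if_reachable[OF A B C zero_less_Suc supp])
qed

theorem mainTheorem5:
  fixes A B C :: "real mat" and N m n :: nat
  assumes "A \<in> carrier_mat N N" and "B \<in> carrier_mat N m" and "C \<in> carrier_mat n N"
  shows "(\<forall>i::nat. R_idx A B C i \<le> int (rk N (ctrb_mat A B)) - int (rk N (A * ctrb_mat A B))
                \<and> int (rk N (ctrb_mat A B)) - int (rk N (A * ctrb_mat A B)) \<le> int N - int (rk N A))
       \<and> (\<forall>s::nat. 0 < s \<and> s \<le> m \<longrightarrow> rk n (C * ctrb_mat A B) = n
                \<longrightarrow> int s \<ge> int (rk N (ctrb_mat A B)) - int (rk N (A * ctrb_mat A B))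
                \<longrightarrow> output_sparse_controllable A B C s)"
proof (intro conjI allI impI)
  fix i
  show "R_idx A B C i \<le> int (rk N (ctrb_mat A B)) - int (rk N (A * ctrb_mat A B))"
    by (rule R_idx_le_ctrb_rank_drop[OF assms])
  show "int (rk N (ctrb_mat A B)) - int (rk N (A * ctrb_mat A B)) \<le> int N - int (rk N A)"
    by (rule ctrb_rank_drop_le_nullity[OF assms(1,2)])
next
  fix s :: nat
  assume "0 < s \<and> s \<le> m" "rk n (C * ctrb_mat A B) = n"
    "int s \<ge> int (rk N (ctrb_mat A B)) - int (rk N (A * ctrb_mat A B))"
  then show "output_sparse_controllable A B C s"
    using ctrb_output_sparse_controllable[OF assms] by simp
qed

end
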